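(* Let $G=(V,\mathcal{E},w)$ be an undirected, connected, weighted graph on $n$ nodes with Laplacian $L$ and largest Laplacian eigenvalue $\lambda_n$. Let $\tau\ge0$ with $\tau\lambda_n<\pi/2$. Consider $$\dot x(t)=-L\,x(t-\tau)+B\,\xi(t),\qquad y(t)=M_n x(t),$$ where $B\in\mathbb{R}^{n\times m}$ and $\xi=(\xi_1,\dots,\xi_m)^T$ consists of mutually independent zero-mean Gaussian white noises, $\xi_k$ with intensity $\sigma_k^2$. Then the performance $\rho_{ss}(L;\tau)$ is a function of $L$, $B$ and $\tau$ (and the $\sigma_k$). If the noise components are indexed by agents ($m=n$), then $$\rho_{ss}(L;\tau)=\sum_{i\in V}\eta_i\sigma_i^2,\qquad \eta_i=\frac12\Big[B^{T}L^{\dagger}\cos(\tau L)\big(M_n-\sin(\tau L)\big)^{\dagger}B\Big]_{ii}.$$ If the noise components are indexed by links ($m=|\mathcal E|$), then $$\rho_{ss}(L;\tau)=\sum_{e\in\mathcal E}\nu_e\sigma_e^2,\qquad \nu_e=\frac12\Big[B^{T}L^{\dagger}\cos(\tau L)\big(M_n-\sin(\tau L)\big)^{\dagger}B\Big]_{ee}.$$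
   Context: Notation: - $M_n=I_n-\frac1n\mathbf 1_n\mathbf 1_n^{T}$. - $X^{\dagger}$ is the Moore–Penrose pseudo-inverse. - $\cos(X)=\sum_{k\ge0}\frac{(-1)^kX^{2k}}{(2k)!}$ and $\sin(X)=\sum_{k\ge0}\frac{(-1)^kX^{2k+1}}{(2k+1)!}$. The performance of the network is $$\rho_{ss}(L;\tau)=\lim_{t\to\infty}\mathbb E[y(t)^Ty(t)].$$ Equivalently, $$\rho_{ss}=\frac1{2\pi}\int_{-\infty}^{\infty}\mathrm{Tr}[G(j\omega)^HG(j\omega)]d\omega,\qquad G(s)=M_n(sI_n+e^{-\tau s}L)^{-1}B\,\mathrm{diag}(\sigma_1,\dots,\sigma_m).$$ The centrality indices are $\eta_i=\partial\rho_{ss}/\partial\sigma_i^2$ (agent noise) and $\nu_e=\partial\rho_{ss}/\partial\sigma_e^2$ (link noise). *)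

theory Defs
  imports "HOL-Analysis.Analysis"
begin

text \<open>Weighted undirected graphs on the node type 'n, given by a weight matrix W.\<close>

definition weighted_graph :: "real^'n^'n \<Rightarrow> bool" where
  "weighted_graph W \<longleftrightarrow> transpose W = W \<and> (\<forall>i j. W$i$j \<ge> 0) \<and> (\<forall>i. W$i$i = 0)"

definition edges :: "real^'n^'n \<Rightarrow> ('n \<times> 'n) set" where
  "edges W = {(i, j). W$i$j > 0}"

definition connected_graph :: "real^'n^'n \<Rightarrow> bool" where
  "connected_graph W \<longleftrightarrow> (\<forall>i j. (i, j) \<in> (edges W)\<^sup>*)"

definition laplacian :: "real^'n^'n \<Rightarrow> real^'n^'n" where
  "laplacian W = (\<chi> i j. (if i = j then (\<Sum>k\<in>UNIV. W$i$k) else 0) - W$i$j)"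

text \<open>Largest eigenvalue (of a symmetric real matrix).\<close>
definition max_eigenvalue :: "real^'n^'n \<Rightarrow> real" where
  "max_eigenvalue A = Max {c. \<exists>v. v \<noteq> 0 \<and> A *v v = c *\<^sub>R v}"

text \<open>Centering matrix M_n = I - (1/n) 1 1^T.\<close>
definition centering :: "'a::field^'n^'n" where
  "centering = (\<chi> i j. (if i = j then 1 else 0) - 1 / of_nat CARD('n))"

text \<open>Moore--Penrose pseudo-inverse.\<close>
definition pinv :: "real^'n^'m \<Rightarrow> real^'m^'n" where
  "pinv A = (THE X. A ** X ** A = A \<and> X ** A ** X = X \<and>
       transpose (A ** X) = A ** X \<and> transpose (X ** A) = X ** A)"

definition matpow :: "'a::semiring_1^'n^'n \<Rightarrow> nat \<Rightarrow> 'a^'n^'n" where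
  "matpow X k = ((\<lambda>Y. X ** Y) ^^ k) (mat 1)"

definition mat_cos :: "real^'n^'n \<Rightarrow> real^'n^'n" where
  "mat_cos X = (\<Sum>k. ((-1)^k / fact (2*k)) *\<^sub>R matpow X (2*k))"

definition mat_sin :: "real^'n^'n \<Rightarrow> real^'n^'n" where
  "mat_sin X = (\<Sum>k. ((-1)^k / fact (2*k+1)) *\<^sub>R matpow X (2*k+1))"

definition cmat :: "real^'n^'m \<Rightarrow> complex^'n^'m" where
  "cmat A = (\<chi> i j. complex_of_real (A$i$j))"

definition diagm :: "'a::zero^'n \<Rightarrow> 'a^'n^'n" where
  "diagm d = (\<chi> i j. if i = j then d$i else 0)"

text \<open>Transfer function G(s) = M_n (s I + e^{-tau s} L)^{-1} B diag(sigma).\<close>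
definition transfer :: "real^'n^'n \<Rightarrow> real \<Rightarrow> real^'m^'n \<Rightarrow> real^'m \<Rightarrow> complex \<Rightarrow> complex^'m^'n" where
  "transfer L \<tau> B \<sigma> s = centering ** matrix_inv (mat s + mat (exp (- (complex_of_real \<tau> * s))) ** cmat L)
      ** cmat B ** cmat (diagm \<sigma>)"

text \<open>Tr[G^H G] = sum of squared moduli of the entries.\<close>
definition trace_GHG :: "complex^'m^'n \<Rightarrow> real" where
  "trace_GHG G = (\<Sum>i\<in>UNIV. \<Sum>k\<in>UNIV. (cmod (G$i$k))^2)"

text \<open>H2 performance rho_ss = (1/2pi) int Tr[G(jw)^H G(jw)] dw.\<close>
definition rho_ss :: "real^'n^'n \<Rightarrow> real \<Rightarrow> real^'m^'n \<Rightarrow> real^'m \<Rightarrow> real" where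
  "rho_ss L \<tau> B \<sigma> = (1 / (2 * pi)) * (LINT \<omega>|lborel. trace_GHG (transfer L \<tau> B \<sigma> (\<i> * complex_of_real \<omega>)))"

end

theory Submission
  imports Defs "HOL-Complex_Analysis.Cauchy_Integral_Formula"
begin

text \<open>
  Diagonalising \<open>L\<close> by an orthogonal matrix decouples the modes: the trace of \<open>G\<^sup>H G\<close> becomes a
  combination of the terms \<open>1 / |D(i \<omega>)|\<^sup>2\<close> with \<open>D(s) = s + \<lambda> exp (- \<tau> s)\<close>, one for each eigenvalue
  \<open>\<lambda> > 0\<close>, and the zero mode is removed by the centering matrix.

  For \<open>\<lambda> = 1\<close> and \<open>\<tau> = a\<close> put \<open>c = cos a / (2 (1 - sin a))\<close>. The function
  \<open>F(s) = (- s/2 + c s\<^sup>2 + (1/2 + c s) exp (- a s)) / (1 + s\<^sup>2)\<close> satisfies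
  \<open>F(s) D(-s) + F(-s) D(s) = 1\<close>, and \<open>c\<close> is the value for which the poles at \<open>s = \<plusminus>i\<close> cancel.
  Hence \<open>1 / |D(i \<omega>)|\<^sup>2 = (F/D)(i \<omega>) + (F/D)(- i \<omega>)\<close> on the imaginary axis. Since \<open>a < \<pi>/2\<close>, \<open>D\<close> has
  no zeros in the closed right half plane, where \<open>F/D - c/(1+s)\<close> is therefore holomorphic and
  \<open>O(1/|s|\<^sup>2)\<close>; its integral along the axis vanishes, so the integral of \<open>1 / |D|\<^sup>2\<close> equals that of
  \<open>2 c / (1 + \<omega>\<^sup>2)\<close>, which is \<open>2 \<pi> c\<close>.
\<close>

subsection \<open>The frequency integral of a single mode\<close>

text \<open>A zero with \<open>Re s \<ge> 0\<close> has modulus at most \<open>l\<close>, since the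
  exponential factor is then at most 1 in modulus. So \<open>\<tau> * Im s\<close> lies within pi/2
  of 0, its cosine is positive, and the real part of the equation is a nonnegative number plus a
  positive one.\<close>

lemma delay_char_nonzero:
  fixes \<tau> l :: real
  assumes "0 \<le> \<tau>" "0 < l" "\<tau> * l < pi / 2" "Re s \<ge> 0"
  shows "s + exp (- (of_real \<tau> * s)) * of_real l \<noteq> 0"
proof
  assume eq: "s + exp (- (of_real \<tau> * s)) * of_real l = 0"
  then have s: "s = - (exp (- (of_real \<tau> * s)) * of_real l)"
    by (simp add: eq_neg_iff_add_eq_0)
  have "cmod s = cmod (exp (- (of_real \<tau> * s)) * of_real l)"
    by (subst s) simp
  also have "\<dots> = exp (- (\<tau> * Re s)) * l"
    using assms by (simp add: norm_mult)
  also have "\<dots> \<le> l"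
    using assms by (simp add: mult_left_le_one_le)
  finally have "\<bar>Im s\<bar> \<le> l"
    using abs_Im_le_cmod[of s] by linarith
  then have "\<bar>\<tau> * Im s\<bar> \<le> \<tau> * l"
    using assms by (simp add: abs_mult mult_left_mono)
  then have "cos (\<tau> * Im s) > 0"
    using assms by (intro cos_gt_zero_pi) auto
  moreover have "Re s + exp (- (\<tau> * Re s)) * cos (\<tau> * Im s) * l = 0"
    using arg_cong[OF eq, of Re] by (simp add: Re_exp)
  ultimately show False
    using assms by (smt (verit) exp_gt_zero mult_pos_pos)
qed

text \<open>The difference quotient has a removable singularity at \<open>a\<close>, filled in by
  the derivative.\<close>

lemma holomorphic_factor_root:
  fixes f :: "complex \<Rightarrow> complex"
  assumes "f holomorphic_on UNIV" "f a = 0"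
  obtains g where "g holomorphic_on UNIV" "\<And>z. f z = (z - a) * g z"
proof
  show "(\<lambda>z. if z = a then deriv f a else (f z - f a) / (z - a)) holomorphic_on UNIV"
    by (rule pole_lemma_open[OF assms(1)]) simp
  show "f z = (z - a) * (if z = a then deriv f a else (f z - f a) / (z - a))" for z
    using assms(2) by simp
qed

text \<open>\<open>F\<close> comes from dividing its numerator \<open>N\<close> by
  \<open>s - \<i>\<close> and then by \<open>s + \<i>\<close>. Multiplied by \<open>1 + s^2\<close>,
  the last identity is pure algebra, using that the two exponentials are mutually inverse.\<close>

lemma delay_bezout:
  fixes a c :: real
  assumes "0 \<le> a" "a < pi / 2"
  defines "c \<equiv> cos a / (2 * (1 - sin a))"
  obtains F :: "complex \<Rightarrow> complex" where "F holomorphic_on UNIV"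
    "\<And>s::complex. (1 + s\<^sup>2) * F s = - s / 2 + c * s\<^sup>2 + (1 / 2 + c * s) * exp (- (of_real a * s))"
    "\<And>s::complex. F s * (- s + exp (of_real a * s)) + F (- s) * (s + exp (- (of_real a * s))) = 1"
proof -
  define N where "N s = - s / 2 + c * s\<^sup>2 + (1 / 2 + c * s) * exp (- (of_real a * s))" for s :: complex
  have sin: "1 - sin a > 0"
    using assms sin_monotone_2pi[of a "pi/2"] by simp
  \<comment> \<open>\<open>cc\<close> and \<open>cs\<close> are the vanishing of the real and the
    imaginary part of \<open>N\<close> at \<open>\<i>\<close>; at \<open>- \<i>\<close> the same two
    conditions arise.\<close>
  have cc: "c * (1 - sin a) = cos a / 2"
    using sin by (simp add: c_def field_simps)
  have cs: "c * cos a = (1 + sin a) / 2"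
  proof -
    have "(1 + sin a) * (1 - sin a) = cos a * cos a"
      using sin_cos_squared_add[of a] by (simp add: algebra_simps power2_eq_square)
    then have "c * cos a = (1 + sin a) * (1 - sin a) / (2 * (1 - sin a))"
      by (simp add: c_def)
    also have "\<dots> = (1 + sin a) / 2"
      using sin by (subst frac_eq_eq) (auto simp: algebra_simps)
    finally show ?thesis .
  qed
  have Nhol: "N holomorphic_on UNIV"
    unfolding N_def by (intro holomorphic_intros) auto
  have N1: "N \<i> = 0"
    using cc cs by (simp add: N_def complex_eq_iff Re_exp Im_exp algebra_simps)
  have N2: "N (- \<i>) = 0"
    using cc cs by (simp add: N_def complex_eq_iff Re_exp Im_exp algebra_simps)
  obtain g where g: "g holomorphic_on UNIV" "\<And>z. N z = (z - \<i>) * g z"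
    using holomorphic_factor_root[OF Nhol N1] by blast
  have "g (- \<i>) = 0"
    using g(2)[of "- \<i>"] N2 by (simp add: complex_eq_iff)
  then obtain F where F: "F holomorphic_on UNIV" "\<And>z. g z = (z - (- \<i>)) * F z"
    using holomorphic_factor_root[OF g(1)] by blast
  have FN: "(1 + s\<^sup>2) * F s = N s" for s
    using g(2)[of s] F(2)[of s] by (simp add: algebra_simps power2_eq_square)
  define k where "k s = F s * (- s + exp (of_real a * s)) + F (- s) * (s + exp (- (of_real a * s))) - 1" for s
  have "F \<circ> uminus holomorphic_on UNIV"
    by (rule holomorphic_on_compose_gen[OF _ F(1)]) (auto intro: holomorphic_intros)
  then have khol: "k holomorphic_on UNIV"
    unfolding k_def o_def by (intro holomorphic_intros F)
  have k0: "(1 + s\<^sup>2) * k s = 0" for s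
  proof -
    have "(1 + s\<^sup>2) * k s = ((1 + s\<^sup>2) * F s) * (- s + exp (of_real a * s))
       + ((1 + (-s)\<^sup>2) * F (-s)) * (s + exp (- (of_real a * s))) - (1 + s\<^sup>2)"
      by (simp add: k_def algebra_simps)
    also have "\<dots> = 0"
      unfolding FN N_def by (simp add: exp_minus field_simps power2_eq_square)
    finally show ?thesis .
  qed
  \<comment> \<open>\<open>k0\<close> allows division only away from \<open>\<i>\<close> and
    \<open>- \<i>\<close>; continuity of \<open>k\<close> covers these two points.\<close>
  have "k s = 0" for s
  proof -
    have "eventually (\<lambda>z. z \<noteq> \<i> \<and> z \<noteq> -\<i>) (at s)"
      by (intro eventually_conj) (metis eventually_at_topological t1_space eventually_neq_at_within)+
    then have "eventually (\<lambda>z. k z = 0) (at s)"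
    proof eventually_elim
      case (elim z)
      then have "(z - \<i>) * (z + \<i>) \<noteq> 0"
        by (simp add: eq_neg_iff_add_eq_0)
      then have "1 + z\<^sup>2 \<noteq> 0"
        by (simp add: algebra_simps power2_eq_square)
      with k0[of z] show ?case by simp
    qed
    then have "(k \<longlongrightarrow> 0) (at s)"
      by (rule tendsto_eventually)
    moreover have "(k \<longlongrightarrow> k s) (at s)"
      using holomorphic_on_imp_continuous_on[OF khol] by (simp add: continuous_on_def)
    ultimately show ?thesis
      using tendsto_unique by (metis trivial_limit_at)
  qed
  then show ?thesis
    using that[OF F(1)] FN unfolding N_def k_def by simp
qed

text \<open>In place of a contour integral, \<open>h\<close> gets a primitive \<open>H\<close> on
  the convex half plane \<open>S\<close>. The integral of \<open>h\<close> along the axis from -iR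
  to iR is then a difference of values of \<open>H\<close>, estimated by passing through the real
  point R.\<close>

lemma delay_integral_unit:
  fixes a :: real
  assumes a: "0 \<le> a" "a < pi / 2"
  shows "integrable lborel (\<lambda>u. 1 / (cmod (\<i> * of_real u + exp (- (of_real a * (\<i> * of_real u)))))\<^sup>2)"
    and "(LINT u|lborel. 1 / (cmod (\<i> * of_real u + exp (- (of_real a * (\<i> * of_real u)))))\<^sup>2)
           = pi * cos a / (1 - sin a)"
proof -
  define c where "c = cos a / (2 * (1 - sin a))"
  define D where "D s = s + exp (- (of_real a * s))" for s :: complex
  define S where "S = {s. Re s \<ge> 0}"
  obtain F :: "complex \<Rightarrow> complex" where F: "F holomorphic_on UNIV"
    and FN: "\<And>s::complex. (1 + s\<^sup>2) * F s = - s / 2 + c * s\<^sup>2 + (1 / 2 + c * s) * exp (- (of_real a * s))"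
    and FD: "\<And>s::complex. F s * D (- s) + F (- s) * D s = 1"
    using delay_bezout[OF a] unfolding c_def D_def by (auto simp: algebra_simps)
  have Dnz: "D s \<noteq> 0" if "s \<in> S" for s
    using delay_char_nonzero[of a 1 s] a that by (simp add: D_def S_def)
  have s1nz: "1 + s \<noteq> 0" if "s \<in> S" for s
    using that by (auto simp: S_def complex_eq_iff)
  define h where "h s = F s / D s - c / (1 + s)" for s :: complex
  have Dhol: "D holomorphic_on A" for A
    unfolding D_def by (intro holomorphic_intros)
  have hhol: "h holomorphic_on S"
    unfolding h_def using Dnz s1nz
    by (intro holomorphic_intros Dhol holomorphic_on_subset[OF F]) auto
  have "convex S"
    unfolding S_def by (rule convex_halfspace_Re_ge)
  moreover have "h field_differentiable at x" if "x \<in> interior S - {}" for x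
    using that holomorphic_on_imp_differentiable_at[of h "interior S" x]
      holomorphic_on_subset[OF hhol interior_subset] by auto
  ultimately obtain H where H: "\<And>x. x \<in> S \<Longrightarrow> (H has_field_derivative h x) (at x within S)"
    using holomorphic_convex_primitive[of S "{}" h] holomorphic_on_imp_continuous_on[OF hhol]
    by (metis finite.emptyI)
  \<comment> \<open>The two summands into which \<open>h\<close> is split below contribute
    \<open>4 + 8 * \<bar>c\<bar>\<close> and \<open>8 * \<bar>c\<bar>\<close>.\<close>
  define C where "C = 4 + 16 * \<bar>c\<bar>"
  have hbound: "cmod (h s) \<le> C / (cmod s)\<^sup>2" if s: "s \<in> S" "cmod s \<ge> 2" for s
  proof -
    define E where "E = exp (- (of_real a * s))"
    define r where "r = cmod s"
    have r: "r \<ge> 2" using s by (simp add: r_def)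
    have E: "cmod E \<le> 1"
      using s a by (simp add: E_def S_def norm_exp_eq_Re)
    have Dge: "cmod (D s) \<ge> r / 2"
    proof -
      have "cmod s - cmod E \<le> cmod (D s)"
        using norm_triangle_ineq2[of s "-E"] unfolding D_def E_def by simp
      then show ?thesis
        using E r by (simp add: r_def)
    qed
    have s1ge: "cmod (1 + s) \<ge> r / 2"
      using norm_triangle_ineq2[of s "-1"] r by (simp add: r_def add.commute)
    have s2ge: "cmod (1 + s\<^sup>2) \<ge> r\<^sup>2 / 2"
    proof -
      have "cmod (1 + s\<^sup>2) \<ge> r\<^sup>2 - 1"
        using norm_triangle_ineq2[of "s\<^sup>2" "-1"] by (simp add: r_def norm_power add.commute)
      moreover have "r\<^sup>2 \<ge> 2"
        using power_mono[OF r, of 2] by simp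
      ultimately show ?thesis by simp
    qed
    \<comment> \<open>Subtracting \<open>c\<close> removes the quadratic term of the numerator. What
      remains grows linearly, so \<open>F s - c\<close> is O(1/r).\<close>
    have "(1 + s\<^sup>2) * (F s - c) = - s / 2 + (1 / 2 + c * s) * E - c"
      using FN[of s] by (simp add: algebra_simps E_def)
    then have "cmod (1 + s\<^sup>2) * cmod (F s - c) = cmod (- s / 2 + (1 / 2 + c * s) * E - c)"
      by (metis norm_mult)
    also have "\<dots> \<le> cmod (- s / 2) + cmod ((1 / 2 + c * s) * E) + cmod (of_real c)"
      by (meson norm_triangle_ineq norm_triangle_ineq4 add_right_mono order_trans)
    also have "cmod ((1 / 2 + c * s) * E) \<le> cmod (1 / 2 + c * s)"
      using E by (simp add: norm_mult mult_left_le)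
    also have "cmod (1 / 2 + c * s) \<le> 1 / 2 + \<bar>c\<bar> * r"
      using norm_triangle_ineq[of "1/2" "c * s"] by (simp add: norm_mult r_def)
    also have "cmod (- s / 2) + (1 / 2 + \<bar>c\<bar> * r) + cmod (of_real c) \<le> r / 2 + r / 2 + \<bar>c\<bar> * r + \<bar>c\<bar> * r"
    proof -
      have "\<bar>c\<bar> * 1 \<le> \<bar>c\<bar> * r" using r by (intro mult_left_mono) auto
      then show ?thesis using r by (simp add: r_def norm_divide)
    qed
    finally have "cmod (1 + s\<^sup>2) * cmod (F s - c) \<le> (1 + 2 * \<bar>c\<bar>) * r"
      by (simp add: algebra_simps)
    moreover have "r\<^sup>2 / 2 * cmod (F s - c) \<le> cmod (1 + s\<^sup>2) * cmod (F s - c)"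
      using s2ge by (intro mult_right_mono) auto
    ultimately have "r * (r * cmod (F s - c)) \<le> r * (2 * (1 + 2 * \<bar>c\<bar>))"
      by (simp add: power2_eq_square algebra_simps)
    then have "r * cmod (F s - c) \<le> 2 * (1 + 2 * \<bar>c\<bar>)"
      using r by (subst (asm) mult_le_cancel_left_pos) auto
    then have Fc: "cmod (F s - c) \<le> 2 * (1 + 2 * \<bar>c\<bar>) / r"
      using r by (simp add: pos_le_divide_eq mult.commute)
    \<comment> \<open>Each summand decays like 1/r^2: in the second one \<open>c / D s\<close> and
      \<open>c / (1 + s)\<close> are combined, and \<open>D s\<close> differs from
      \<open>1 + s\<close> only by the bounded \<open>1 - E\<close>.\<close>
    have "h s = (F s - c) / D s + c * (1 - E) / (D s * (1 + s))"
    proof -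
      have "c * (1 - E) = c * (1 + s) - c * D s"
        by (simp add: D_def E_def algebra_simps)
      then have "c * (1 - E) / (D s * (1 + s)) = c / D s - c / (1 + s)"
        using Dnz[OF s(1)] s1nz[OF s(1)] by (simp add: diff_frac_eq)
      then show ?thesis
        by (simp add: h_def diff_divide_distrib)
    qed
    also have "cmod \<dots> \<le> cmod (F s - c) / cmod (D s) + \<bar>c\<bar> * cmod (1 - E) / (cmod (D s) * cmod (1 + s))"
      by (rule order_trans[OF norm_triangle_ineq]) (simp add: norm_divide norm_mult)
    also have "\<dots> \<le> (2 * (1 + 2 * \<bar>c\<bar>) / r) / (r / 2) + \<bar>c\<bar> * 2 / (r / 2 * (r / 2))"
    proof (intro add_mono frac_le mult_mono mult_left_mono)
      show "cmod (1 - E) \<le> 2"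
        using norm_triangle_ineq4[of 1 E] E by simp
    qed (use Fc Dge s1ge r in auto)
    also have "\<dots> = C / r\<^sup>2"
      using r by (simp add: C_def field_simps power2_eq_square)
    finally show ?thesis by (simp add: r_def)
  qed
  \<comment> \<open>On the segment \<open>\<bar>Re z\<bar> + \<bar>Im z\<bar> = R\<close>, so
    \<open>cmod z \<ge> R / 2\<close>, and \<open>R \<ge> 4\<close> puts this in the range of
    \<open>hbound\<close>. The bound is then \<open>4 * C / R^2\<close> for the derivative times
    \<open>2 * R\<close> for the length.\<close>
  have Hseg: "cmod (H x - H y) \<le> 8 * C / R"
    if xy: "x = of_real R" "y = \<i> * of_real R \<or> y = - (\<i> * of_real R)" and R: "R \<ge> 4" for x y R
  proof -
    have sub: "closed_segment x y \<subseteq> S"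
      using xy R \<open>convex S\<close> by (intro closed_segment_subset) (auto simp: S_def)
    have nrm: "cmod z \<ge> R / 2" if z: "z \<in> closed_segment x y" for z
    proof -
      obtain t where t: "0 \<le> t" "t \<le> 1" "z = (1 - t) *\<^sub>R x + t *\<^sub>R y"
        using z by (auto simp: in_segment)
      have "\<bar>Re z\<bar> = (1 - t) * R" "\<bar>Im z\<bar> = t * R"
        using t xy R by (auto simp: abs_mult)
      then have "\<bar>Re z\<bar> + \<bar>Im z\<bar> = R" by (simp add: algebra_simps)
      then show ?thesis
        using abs_Re_le_cmod[of z] abs_Im_le_cmod[of z] by linarith
    qed
    have "cmod (H x - H y) \<le> (C / (R / 2)\<^sup>2) * cmod (x - y)"
    proof (rule field_differentiable_bound[of "closed_segment x y" H h])
      fix z assume z: "z \<in> closed_segment x y"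
      show "(H has_field_derivative h z) (at z within closed_segment x y)"
        using H sub z by (meson DERIV_subset subsetD)
      have "cmod (h z) \<le> C / (cmod z)\<^sup>2"
        using hbound[of z] nrm[OF z] sub z R by auto
      also have "\<dots> \<le> C / (R / 2)\<^sup>2"
        using nrm[OF z] R by (intro divide_left_mono power_mono mult_pos_pos zero_less_power) (auto simp: C_def)
      finally show "cmod (h z) \<le> C / (R / 2)\<^sup>2" .
    qed auto
    also have "\<dots> \<le> (C / (R / 2)\<^sup>2) * (2 * R)"
      using norm_triangle_ineq4[of x y] xy R by (intro mult_left_mono) (auto simp: norm_mult C_def)
    also have "\<dots> = 8 * C / R"
      using R by (simp add: field_simps power2_eq_square)
    finally show ?thesis .
  qed
  define f where "f u = 1 / (cmod (D (\<i> * of_real u)))\<^sup>2" for u :: real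
  have im: "\<i> * of_real u \<in> S" "- (\<i> * of_real u) \<in> S" for u
    by (auto simp: S_def)
  \<comment> \<open>On the imaginary axis \<open>D\<close> takes conjugate values at opposite
    points, so their product is the squared modulus and \<open>FD\<close> turns the sum of the two
    quotients into \<open>f u\<close>.\<close>
  have hsum: "h (\<i> * of_real u) + h (- (\<i> * of_real u)) = of_real (f u - 2 * c / (1 + u\<^sup>2))" for u
  proof -
    let ?s = "\<i> * of_real u"
    have "D (- ?s) = cnj (D ?s)"
      by (simp add: D_def exp_cnj)
    then have DD: "D ?s * D (- ?s) = of_real ((cmod (D ?s))\<^sup>2)"
      by (metis complex_norm_square of_real_power)
    have "F ?s / D ?s + F (- ?s) / D (- ?s) = (F ?s * D (- ?s) + F (- ?s) * D ?s) / (D ?s * D (- ?s))"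
      using Dnz[OF im(1)[of u]] Dnz[OF im(2)[of u]] by (simp add: add_frac_eq)
    also have "\<dots> = of_real (f u)"
      unfolding FD DD f_def by simp
    finally have 1: "F ?s / D ?s + F (- ?s) / D (- ?s) = of_real (f u)" .
    have 2: "c / (1 + ?s) + c / (1 + (- ?s)) = of_real (2 * c / (1 + u\<^sup>2))"
    proof -
      have "(1 + ?s) * (1 + (- ?s)) = of_real (1 + u\<^sup>2)"
        by (simp add: algebra_simps power2_eq_square)
      moreover have "c / (1 + ?s) + c / (1 + (- ?s)) = (c * (1 + (- ?s)) + c * (1 + ?s)) / ((1 + ?s) * (1 + (- ?s)))"
        using s1nz[OF im(1)[of u]] s1nz[OF im(2)[of u]] by (rule add_frac_eq)
      ultimately show ?thesis by (simp add: algebra_simps)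
    qed
    show ?thesis
      using 1 2 unfolding h_def of_real_diff by (simp add: algebra_simps)
  qed
  \<comment> \<open>A primitive of \<open>f\<close>. Division by \<open>\<i>\<close> undoes the
    factor from differentiating along the axis, and the arctangent restores the term subtracted in
    \<open>hsum\<close>. Only the arctangent survives in the limit.\<close>
  define P where "P u = Re ((H (\<i> * of_real u) - H (- (\<i> * of_real u))) / \<i>) + 2 * c * arctan u" for u
  have dP: "(P has_real_derivative f u) (at u)" for u
  proof -
    have "((\<lambda>u. \<i> * of_real u) has_vector_derivative \<i>) (at u)"
      by (auto intro!: derivative_eq_intros)
    then have 1: "((H \<circ> (\<lambda>u. \<i> * of_real u)) has_vector_derivative \<i> * h (\<i> * of_real u)) (at u)"
      by (rule field_vector_diff_chain_within)
        (rule DERIV_subset[OF H], use im in auto)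
    have "((\<lambda>u. - (\<i> * of_real u)) has_vector_derivative - \<i>) (at u)"
      by (auto intro!: derivative_eq_intros)
    then have 2: "((H \<circ> (\<lambda>u. - (\<i> * of_real u))) has_vector_derivative - \<i> * h (- (\<i> * of_real u))) (at u)"
      by (rule field_vector_diff_chain_within)
        (rule DERIV_subset[OF H], use im in auto)
    have "((\<lambda>u. (H (\<i> * of_real u) - H (- (\<i> * of_real u))) / \<i>) has_vector_derivative
            (\<i> * h (\<i> * of_real u) - (- \<i> * h (- (\<i> * of_real u)))) / \<i>) (at u)"
      using has_vector_derivative_diff[OF 1 2, unfolded o_def]
      by (rule has_vector_derivative_divide)
    also have "(\<i> * h (\<i> * of_real u) - (- \<i> * h (- (\<i> * of_real u)))) / \<i> = of_real (f u - 2 * c / (1 + u\<^sup>2))"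
      unfolding hsum[symmetric] by (simp add: field_simps)
    finally have "((\<lambda>u. Re ((H (\<i> * of_real u) - H (- (\<i> * of_real u))) / \<i>)) has_vector_derivative
            Re (of_real (f u - 2 * c / (1 + u\<^sup>2)))) (at u)"
      by (rule bounded_linear.has_vector_derivative[OF bounded_linear_Re])
    then have "((\<lambda>u. Re ((H (\<i> * of_real u) - H (- (\<i> * of_real u))) / \<i>)) has_real_derivative
            f u - 2 * c / (1 + u\<^sup>2)) (at u)"
      by (simp add: has_real_derivative_iff_has_vector_derivative)
    moreover have "((\<lambda>u. 2 * c * arctan u) has_real_derivative 2 * c / (1 + u\<^sup>2)) (at u)"
      by (auto intro!: derivative_eq_intros simp: divide_inverse)
    ultimately show ?thesis
      unfolding P_def using DERIV_add by fastforce
  qed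
  have contf: "isCont f u" for u
  proof -
    have "continuous_on UNIV f"
      using Dnz[OF im(1)] unfolding f_def D_def by (intro continuous_intros) auto
    then show ?thesis
      by (simp add: continuous_on_eq_continuous_at)
  qed
  have Hsmall: "((\<lambda>u. Re ((H (\<i> * of_real u) - H (- (\<i> * of_real u))) / \<i>)) \<longlongrightarrow> 0) at_top"
  proof (rule Lim_null_comparison)
    show "eventually (\<lambda>u. norm (Re ((H (\<i> * of_real u) - H (- (\<i> * of_real u))) / \<i>)) \<le> 16 * C / u) at_top"
      using eventually_ge_at_top[of 4]
    proof eventually_elim
      case (elim u)
      let ?x = "H (of_real u)" and ?y = "H (\<i> * of_real u)" and ?z = "H (- (\<i> * of_real u))"
      have "norm (Re ((?y - ?z) / \<i>)) \<le> cmod (?y - ?z)"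
        using abs_Im_le_cmod[of "?y - ?z"] by simp
      also have "\<dots> \<le> cmod (?x - ?y) + cmod (?x - ?z)"
        by (metis norm_minus_commute norm_triangle_sub diff_add_cancel norm_triangle_ineq add_diff_eq)
      also have "\<dots> \<le> 8 * C / u + 8 * C / u"
        using elim by (intro add_mono Hseg) auto
      finally show ?case by simp
    qed
    show "((\<lambda>u. 16 * C / u) \<longlongrightarrow> 0) at_top"
      by (intro tendsto_divide_0[OF tendsto_const] filterlim_at_top_imp_at_infinity filterlim_ident)
  qed
  have top: "(P \<longlongrightarrow> c * pi) at_top"
  proof -
    have "(P \<longlongrightarrow> 0 + 2 * c * (pi / 2)) at_top"
      unfolding P_def by (intro tendsto_intros Hsmall tendsto_arctan_at_top)
    then show ?thesis by (simp add: mult.commute)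
  qed
  have odd: "P (- u) = - P u" for u
    by (simp add: P_def arctan_minus)
  have bot: "(P \<longlongrightarrow> - (c * pi)) at_bot"
    using tendsto_minus[OF top] unfolding filterlim_at_bot_mirror odd .
  have fnn: "f u \<ge> 0" for u
    by (simp add: f_def)
  have lim1: "((P \<circ> real_of_ereal) \<longlongrightarrow> - (c * pi)) (at_right (- \<infinity>))"
    using bot by (simp add: ereal_tendsto_simps)
  have lim2: "((P \<circ> real_of_ereal) \<longlongrightarrow> c * pi) (at_left \<infinity>)"
    using top by (simp add: ereal_tendsto_simps)
  \<comment> \<open>As \<open>f\<close> is nonnegative, the finite limits of its primitive yield
    integrability as well as the value.\<close>
  note ftc = interval_integral_FTC_nonneg[of "- \<infinity>" \<infinity> P f, OF _ dP contf _ lim1 lim2]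
  have "integrable lborel f"
    using ftc(1) fnn by (simp add: set_integrable_def)
  then show "integrable lborel (\<lambda>u. 1 / (cmod (\<i> * of_real u + exp (- (of_real a * (\<i> * of_real u)))))\<^sup>2)"
    unfolding f_def[abs_def] D_def .
  have "(LINT u|lborel. f u) = 2 * c * pi"
    using ftc(2) fnn by (simp add: interval_lebesgue_integral_def set_lebesgue_integral_def)
  moreover have c2: "2 * c = cos a / (1 - sin a)"
    unfolding c_def by (simp del: right_diff_distrib_numeral)
  ultimately show "(LINT u|lborel. 1 / (cmod (\<i> * of_real u + exp (- (of_real a * (\<i> * of_real u)))))\<^sup>2)
           = pi * cos a / (1 - sin a)"
    unfolding f_def D_def using c2 by (simp add: mult.commute)
qed

text \<open>Substituting \<open>l * u\<close> for the frequency pulls a factor \<open>l\<close> out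
  of the denominator and turns the delay into \<open>\<tau> * l\<close>. The square of that factor
  against the Jacobian \<open>l\<close> leaves \<open>1 / l\<close> times the unit integral.\<close>

lemma delay_integral:
  fixes l \<tau> :: real
  assumes "l > 0" "\<tau> \<ge> 0" "\<tau> * l < pi / 2"
  shows "integrable lborel (\<lambda>u. 1 / (cmod (\<i> * of_real u + exp (- (of_real \<tau> * (\<i> * of_real u))) * of_real l))\<^sup>2)"
    and "(LINT u|lborel. 1 / (cmod (\<i> * of_real u + exp (- (of_real \<tau> * (\<i> * of_real u))) * of_real l))\<^sup>2)
           = pi * cos (\<tau> * l) / (l * (1 - sin (\<tau> * l)))"
proof -
  let ?g = "\<lambda>u. 1 / (cmod (\<i> * of_real u + exp (- (of_real \<tau> * (\<i> * of_real u))) * of_real l))\<^sup>2"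
  let ?f = "\<lambda>u. 1 / (cmod (\<i> * of_real u + exp (- (of_real (\<tau> * l) * (\<i> * of_real u)))))\<^sup>2"
  have gf: "?g (0 + l * u) = ?f u / l\<^sup>2" for u
  proof -
    have "\<i> * of_real (0 + l * u) + exp (- (of_real \<tau> * (\<i> * of_real (0 + l * u)))) * of_real l
      = of_real l * (\<i> * of_real u + exp (- (of_real (\<tau> * l) * (\<i> * of_real u))))"
      by (simp add: algebra_simps)
    then show ?thesis
      using assms by (simp add: norm_mult power_mult_distrib)
  qed
  have a: "0 \<le> \<tau> * l" using assms by simp
  note U = delay_integral_unit[OF a assms(3)]
  show "integrable lborel ?g"
    using lborel_integrable_real_affine_iff[of l ?g 0] integrable_divide[OF U(1), of "l\<^sup>2"] assms(1)
    unfolding gf by simp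
  show "(LINT u|lborel. ?g u) = pi * cos (\<tau> * l) / (l * (1 - sin (\<tau> * l)))"
    using lborel_integral_real_affine[of l ?g 0] U(2) assms(1) unfolding gf
    by (simp add: power2_eq_square mult.commute[of l "1 - _"] divide_divide_eq_left[symmetric]
        del: divide_divide_eq_left of_real_mult)
qed

subsection \<open>Orthogonal diagonalisation of symmetric matrices\<close>

lemma inner_matrix_vector_symmetric:
  fixes A :: "real^'n^'n"
  assumes "transpose A = A"
  shows "(A *v x) \<bullet> y = x \<bullet> (A *v y)"
  by (metis assms dot_lmul_matrix transpose_matrix_vector)

text \<open>A maximiser \<open>v\<close> of the Rayleigh quotient on the unit sphere of
  \<open>S\<close> is an eigenvector: otherwise moving from \<open>v\<close> along the residual
  \<open>w\<close>, which stays in \<open>S\<close> by invariance, would increase the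
  quotient.\<close>

lemma symmetric_eigenvector_in_subspace:
  fixes A :: "real^'n^'n"
  assumes sym: "transpose A = A" and S: "subspace S" "S \<noteq> {0}"
    and inv: "\<And>x. x \<in> S \<Longrightarrow> A *v x \<in> S"
  obtains v c where "v \<in> S" "norm v = 1" "A *v v = c *\<^sub>R v"
proof -
  let ?K = "sphere 0 1 \<inter> S"
  obtain x where x: "x \<in> S" "x \<noteq> 0"
    using S subspace_0 by blast
  then have "x /\<^sub>R norm x \<in> ?K"
    using S by (auto simp: subspace_scale)
  moreover have "compact ?K"
    using S by (intro compact_Int_closed closed_subspace) auto
  moreover have "continuous_on ?K (\<lambda>x. x \<bullet> (A *v x))"
    by (intro continuous_intros)
  ultimately obtain v where v: "v \<in> ?K" and vmax: "\<And>y. y \<in> ?K \<Longrightarrow> y \<bullet> (A *v y) \<le> v \<bullet> (A *v v)"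
    using continuous_attains_sup[of ?K "\<lambda>x. x \<bullet> (A *v x)"] by blast
  define c where "c = v \<bullet> (A *v v)"
  have vv: "v \<bullet> v = 1"
    using v by (simp add: norm_eq_1)
  have le: "y \<bullet> (A *v y) \<le> c * (y \<bullet> y)" if "y \<in> S" for y
  proof (cases "y = 0")
    case False
    have "y /\<^sub>R norm y \<in> ?K"
      using that S False by (auto simp: subspace_scale)
    from vmax[OF this] have "(y \<bullet> (A *v y)) / (norm y)\<^sup>2 \<le> c"
      by (simp add: c_def matrix_vector_mult_scaleR power2_eq_square divide_inverse mult_ac)
    then show ?thesis
      using False by (simp add: divide_le_eq power2_norm_eq_inner)
  qed simp
  define w where "w = A *v v - c *\<^sub>R v"
  have wS: "w \<in> S"
    using v inv S by (simp add: w_def subspace_diff subspace_scale)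
  have wv: "w \<bullet> v = 0"
    by (simp add: w_def inner_diff_left vv c_def inner_commute[of "A *v v"])
  have Avw: "w \<bullet> (A *v v) = w \<bullet> w"
    using wv by (simp add: w_def inner_diff_right)
  define M where "M = c * (w \<bullet> w) - w \<bullet> (A *v w)"
  \<comment> \<open>This is maximality at \<open>v + t *\<^sub>R w\<close>. The left side is of
    first order in \<open>t\<close>, the right side of second order; t = 1 shows
    \<open>M > 0\<close>, and \<open>t = w \<bullet> w / M\<close> then contradicts
    \<open>w \<noteq> 0\<close>.\<close>
  have quad: "2 * t * (w \<bullet> w) \<le> t\<^sup>2 * M" for t
  proof -
    have "v + t *\<^sub>R w \<in> S"
      using v wS S by (simp add: subspace_add subspace_scale)
    from le[OF this] show ?thesis
      using Avw wv vv inner_matrix_vector_symmetric[OF sym, of v w]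
      by (simp add: M_def matrix_vector_right_distrib matrix_vector_mult_scaleR inner_simps
          inner_commute[of v w] inner_commute[of "A *v v" w] c_def[symmetric] algebra_simps power2_eq_square)
  qed
  have "w = 0"
  proof (rule ccontr)
    assume "w \<noteq> 0"
    then have ww: "w \<bullet> w > 0" by simp
    have M: "M > 0" using quad[of 1] ww by (simp only: power_one)
    have "2 * (w \<bullet> w / M) * (w \<bullet> w) \<le> (w \<bullet> w / M)\<^sup>2 * M"
      by (rule quad)
    then have "(w \<bullet> w) * (w \<bullet> w) \<le> 0"
      using M by (simp add: power2_eq_square field_simps)
    then show False
      using mult_pos_pos[OF ww ww] by linarith
  qed
  then show ?thesis
    using that[of v c] v by (simp add: w_def)
qed

text \<open>An orthonormal set of eigenvectors of largest size spans: its orthogonal complement is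
  invariant by symmetry, so if nonzero it would contain a further unit eigenvector.\<close>

lemma symmetric_orthogonal_eigenbasis:
  fixes A :: "real^'n^'n"
  assumes sym: "transpose A = A"
  obtains Q :: "real^'n^'n" and d :: "real^'n"
  where "orthogonal_matrix Q" "\<And>i. A *v column i Q = d$i *\<^sub>R column i Q"
proof -
  define P where "P E \<longleftrightarrow> pairwise orthogonal E \<and> (\<forall>x\<in>E. norm x = 1 \<and> (\<exists>c. A *v x = c *\<^sub>R x))"
    for E :: "(real^'n) set"
  have indep: "independent E" if "P E" for E
    using that by (intro pairwise_orthogonal_independent) (auto simp: P_def)
  have "card E \<le> CARD('n)" if "P E" for E
    using independent_bound[OF indep[OF that]] by simp
  moreover have "P {}" by (simp add: P_def)
  ultimately obtain E where E: "P E" and Emax: "\<And>E'. P E' \<Longrightarrow> card E' \<le> card E"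
    using ex_has_greatest_nat[of P "{}" card "CARD('n) + 1"] by (metis Suc_eq_plus1 le_imp_less_Suc less_imp_le_nat)
  have finE: "finite E"
    using indep[OF E] by (rule finiteI_independent)
  have spanE: "span E = UNIV"
  proof (rule ccontr)
    assume "span E \<noteq> UNIV"
    then obtain x where x: "x \<noteq> 0" "\<And>y. y \<in> span E \<Longrightarrow> orthogonal x y"
      using orthogonal_to_subspace_exists_gen[of E UNIV] by (auto simp: span_UNIV)
    define S where "S = {x. \<forall>e\<in>E. orthogonal x e}"
    have "subspace S"
      by (auto simp: S_def subspace_def orthogonal_def inner_simps)
    moreover have "S \<noteq> {0}"
      using x by (auto simp: S_def span_base)
    moreover have "A *v y \<in> S" if "y \<in> S" for y
      unfolding S_def
    proof (intro CollectI ballI)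
      fix e assume "e \<in> E"
      then obtain c where "A *v e = c *\<^sub>R e" "orthogonal y e"
        using E \<open>y \<in> S\<close> by (auto simp: P_def S_def)
      then show "orthogonal (A *v y) e"
        by (simp add: orthogonal_def inner_matrix_vector_symmetric[OF sym])
    qed
    ultimately obtain v c where v: "v \<in> S" "norm v = 1" "A *v v = c *\<^sub>R v"
      using symmetric_eigenvector_in_subspace[OF sym] by metis
    have "v \<notin> E"
      using v by (force simp: S_def orthogonal_def)
    moreover have "P (insert v E)"
      using E v by (auto simp: P_def S_def pairwise_insert orthogonal_commute)
    ultimately show False
      using Emax[of "insert v E"] finE by simp
  qed
  have "card E = CARD('n)"
    using indep[OF E] spanE by (metis dim_UNIV dim_span_eq_card_independent DIM_cart DIM_real mult.right_neutral)
  then obtain f where f: "bij_betw f (UNIV::'n set) E"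
    using finE by (metis finite_class.finite_UNIV finite_same_card_bij)
  define Q :: "real^'n^'n" where "Q = (\<chi> i j. f j $ i)"
  have col: "column i Q = f i" for i
    by (simp add: Q_def column_def)
  have fE: "f i \<in> E" for i
    using f by (auto simp: bij_betw_def)
  have "orthogonal_matrix Q"
    unfolding orthogonal_matrix_orthonormal_columns col
    using E fE f unfolding P_def pairwise_def bij_betw_def inj_on_def by (metis UNIV_I)
  moreover have "A *v column i Q = (\<chi> i. SOME c. A *v f i = c *\<^sub>R f i) $ i *\<^sub>R column i Q" for i
    using E fE[of i] unfolding col P_def by (auto intro: someI_ex)
  ultimately show ?thesis
    using that by blast
qed

lemma norm_column_orthogonal_matrix:
  fixes Q :: "real^'n^'n"
  shows "orthogonal_matrix Q \<Longrightarrow> norm (column i Q) = 1"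
  by (simp add: orthogonal_matrix_orthonormal_columns)

text \<open>\<open>Max\<close> is informative only on a finite set. Any eigenvector has a nonzero
  inner product with some column of \<open>Q\<close>, and symmetry forces its eigenvalue to be the
  entry of \<open>d\<close> there, so there are finitely many eigenvalues.\<close>

lemma eigenvalue_le_max_eigenvalue:
  fixes A Q :: "real^'n^'n"
  assumes sym: "transpose A = A" and Q: "orthogonal_matrix Q"
    and A: "\<And>i. A *v column i Q = d$i *\<^sub>R column i Q"
  shows "d$i \<le> max_eigenvalue A"
proof -
  let ?S = "{c. \<exists>v. v \<noteq> 0 \<and> A *v v = c *\<^sub>R v}"
  have "?S \<subseteq> range (($) d)"
  proof
    fix c assume "c \<in> ?S"
    then obtain v where v: "v \<noteq> 0" "A *v v = c *\<^sub>R v" by blast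
    have "\<exists>j. column j Q \<bullet> v \<noteq> 0"
    proof (rule ccontr)
      assume "\<not> ?thesis"
      then have "transpose Q *v v = 0"
        by (simp add: vec_eq_iff matrix_vector_mult_def transpose_def column_def inner_vec_def)
      then have "(Q ** transpose Q) *v v = 0"
        by (simp add: matrix_vector_mul_assoc[symmetric])
      then show False
        using Q v by (simp add: orthogonal_matrix_def)
    qed
    then obtain j where j: "column j Q \<bullet> v \<noteq> 0" by blast
    have "(A *v column j Q) \<bullet> v = column j Q \<bullet> (A *v v)"
      by (rule inner_matrix_vector_symmetric[OF sym])
    then have "c = d $ j"
      using j by (simp add: A v)
    then show "c \<in> range (($) d)" by blast
  qed
  then have "finite ?S"
    by (rule finite_subset) simp
  moreover have "column i Q \<noteq> 0"
    using norm_column_orthogonal_matrix[OF Q, of i] by auto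
  then have "d$i \<in> ?S"
    using A by blast
  ultimately show ?thesis
    unfolding max_eigenvalue_def by (rule Max_ge)
qed

subsection \<open>Functions of a diagonalised matrix\<close>

text \<open>Stated over a commutative ring to serve both real matrices and their complexifications.
  The plain transpose suffices over the complex numbers because there \<open>Q\<close> is always the
  image of a real orthogonal matrix.\<close>

definition conj_diag :: "'a::comm_ring_1^'n^'n \<Rightarrow> 'a^'n \<Rightarrow> 'a^'n^'n" where
  "conj_diag Q d = Q ** diagm d ** transpose Q"

lemma matrix_mult_diagm_nth: "(A ** diagm d)$i$j = A$i$j * d$j"
  for A :: "'a::comm_ring_1^'n^'m"
  by (simp add: matrix_matrix_mult_def diagm_def if_distrib cong: if_cong)

lemma diagm_matrix_mult_nth: "(diagm d ** A)$i$j = d$i * A$i$j"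
  for A :: "'a::comm_ring_1^'m^'n"
  by (simp add: matrix_matrix_mult_def diagm_def if_distrib if_distribR cong: if_cong)

lemma conj_diag_nth: "conj_diag Q d $ i $ j = (\<Sum>k\<in>UNIV. Q$i$k * d$k * Q$j$k)"
  unfolding conj_diag_def
  by (subst matrix_matrix_mult_def) (simp add: matrix_mult_diagm_nth transpose_def)

lemma transpose_conj_diag: "transpose (conj_diag Q d) = conj_diag Q d"
  by (simp add: vec_eq_iff transpose_def conj_diag_nth mult_ac)

lemma diagm_mult: "diagm d ** diagm e = diagm (d * e)"
  for d :: "'a::comm_ring_1^'n"
  unfolding vec_eq_iff matrix_mult_diagm_nth by (simp add: diagm_def)

lemma conj_diag_mult:
  assumes "orthogonal_matrix Q"
  shows "conj_diag Q d ** conj_diag Q e = conj_diag Q (d * e)"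
proof -
  have "conj_diag Q d ** conj_diag Q e = Q ** diagm d ** (transpose Q ** Q) ** diagm e ** transpose Q"
    by (simp add: conj_diag_def matrix_mul_assoc)
  also have "\<dots> = Q ** (diagm d ** diagm e) ** transpose Q"
    using assms by (simp add: orthogonal_matrix_def matrix_mul_assoc)
  finally show ?thesis
    by (simp add: diagm_mult conj_diag_def)
qed

lemma conj_diag_const:
  assumes "orthogonal_matrix Q"
  shows "conj_diag Q (\<chi> i. c) = mat c"
proof -
  have "conj_diag Q (\<chi> i. c) $ i $ j = c * (Q ** transpose Q) $ i $ j" for i j
    by (simp add: conj_diag_nth matrix_matrix_mult_def transpose_def sum_distrib_left mult_ac)
  then show ?thesis
    using assms by (simp add: vec_eq_iff orthogonal_matrix_def mat_def)
qed

lemma conj_diag_add: "conj_diag Q d + conj_diag Q e = conj_diag Q (d + e)"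
  by (simp add: vec_eq_iff conj_diag_nth algebra_simps sum.distrib)

lemma conj_diag_diff: "conj_diag Q d - conj_diag Q e = conj_diag Q (d - e)"
  by (simp add: vec_eq_iff conj_diag_nth algebra_simps sum_subtractf)

lemma conj_diag_scaleR: "c *\<^sub>R conj_diag Q d = conj_diag Q (c *\<^sub>R d)"
  for d :: "real^'n"
  by (simp add: vec_eq_iff conj_diag_nth sum_distrib_left mult_ac)

lemma eigenbasis_imp_conj_diag:
  fixes A Q :: "real^'n^'n"
  assumes Q: "orthogonal_matrix Q" and A: "\<And>i. A *v column i Q = d$i *\<^sub>R column i Q"
  shows "A = conj_diag Q d"
proof -
  have "(A ** Q) $ i $ j = (A *v column j Q) $ i" for i j
    by (simp add: matrix_matrix_mult_def matrix_vector_mult_def column_def)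
  then have "A ** Q = Q ** diagm d"
    unfolding A by (simp add: vec_eq_iff matrix_mult_diagm_nth column_def)
  then have "A ** (Q ** transpose Q) = conj_diag Q d"
    by (simp add: conj_diag_def matrix_mul_assoc)
  then show ?thesis
    using Q by (simp add: orthogonal_matrix_def)
qed

text \<open>Uniqueness of the Moore-Penrose inverse: transposing
  \<open>A ** X = (A ** Y) ** (A ** X)\<close> gives \<open>A ** X = A ** Y\<close>, similarly
  \<open>X ** A = Y ** A\<close>, and then \<open>Y = Y ** A ** Y = X ** A ** X = X\<close>.\<close>

lemma pinv_eqI:
  fixes A :: "real^'n^'m"
  assumes "A ** X ** A = A" "X ** A ** X = X" "transpose (A ** X) = A ** X" "transpose (X ** A) = X ** A"
  shows "pinv A = X"
  unfolding pinv_def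
proof (rule the_equality)
  fix Y
  assume Y: "A ** Y ** A = A \<and> Y ** A ** Y = Y \<and> transpose (A ** Y) = A ** Y \<and> transpose (Y ** A) = Y ** A"
  have "A ** X = (A ** Y) ** (A ** X)"
    using Y by (simp add: matrix_mul_assoc)
  then have AX: "A ** X = A ** Y"
    using Y assms by (metis matrix_transpose_mul matrix_mul_assoc)
  have "X ** A = (X ** A) ** (Y ** A)"
    using Y by (metis matrix_mul_assoc)
  then have XA: "X ** A = Y ** A"
    using Y assms by (metis matrix_transpose_mul matrix_mul_assoc)
  show "Y = X"
    using Y assms AX XA by (metis matrix_mul_assoc)
qed (use assms in auto)

text \<open>The convention \<open>inverse 0 = 0\<close> makes the entrywise inverse the
  pseudo-inverse, zero eigenvalues included.\<close>

lemma pinv_conj_diag: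
  assumes "orthogonal_matrix Q"
  shows "pinv (conj_diag Q d) = conj_diag Q (\<chi> i. inverse (d$i))"
proof -
  have "d * (\<chi> i. inverse (d$i)) * d = d"
    "(\<chi> i. inverse (d$i)) * d * (\<chi> i. inverse (d$i)) = (\<chi> i. inverse (d$i))"
    by (simp_all add: vec_eq_iff) (metis right_inverse left_inverse)+
  then show ?thesis
    using assms by (intro pinv_eqI) (simp_all add: conj_diag_mult transpose_conj_diag)
qed

lemma matpow_conj_diag:
  assumes "orthogonal_matrix Q"
  shows "matpow (conj_diag Q d) k = conj_diag Q (\<chi> i. d$i ^ k)"
proof (induction k)
  case 0
  show ?case
    using conj_diag_const[OF assms, of 1] by (simp add: matpow_def)
next
  case (Suc k)
  have "d * (\<chi> i. d$i ^ k) = (\<chi> i. d$i ^ Suc k)"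
    by (simp add: vec_eq_iff)
  then show ?case
    using Suc by (simp add: matpow_def conj_diag_mult[OF assms])
qed

lemma sums_vecI:
  assumes "\<And>i. (\<lambda>k. f k $ i) sums (s $ i)"
  shows "f sums s"
  using assms unfolding sums_def by (intro vec_tendstoI) simp

lemma conj_diag_sums:
  fixes Q :: "real^'n^'n"
  assumes "\<And>i. (\<lambda>k. f k $ i) sums (s $ i)"
  shows "(\<lambda>k. conj_diag Q (f k)) sums conj_diag Q s"
  by (intro sums_vecI) (simp only: conj_diag_nth, intro sums_sum sums_mult sums_mult2 assms)

lemma mat_cos_conj_diag:
  assumes "orthogonal_matrix Q"
  shows "mat_cos (conj_diag Q d) = conj_diag Q (\<chi> i. cos (d$i))"
  unfolding mat_cos_def matpow_conj_diag[OF assms] conj_diag_scaleR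
  using cos_paired
  by (intro sums_unique[symmetric] conj_diag_sums) (simp del: of_nat_fact)

lemma mat_sin_conj_diag:
  assumes "orthogonal_matrix Q"
  shows "mat_sin (conj_diag Q d) = conj_diag Q (\<chi> i. sin (d$i))"
  unfolding mat_sin_def matpow_conj_diag[OF assms] conj_diag_scaleR
  using sin_paired
  by (intro sums_unique[symmetric] conj_diag_sums) (simp del: of_nat_fact)

lemma matrix_inv_eqI:
  fixes A :: "'a::semiring_1^'n^'n"
  assumes "A ** B = mat 1" "B ** A = mat 1"
  shows "matrix_inv A = B"
proof -
  have "A ** matrix_inv A = mat 1"
    unfolding matrix_inv_def using assms by (metis (mono_tags, lifting) someI_ex)
  then show ?thesis
    using assms(2) by (metis matrix_mul_assoc matrix_mul_lid matrix_mul_rid)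
qed

lemma matrix_inv_conj_diag:
  fixes Q :: "'a::field^'n^'n"
  assumes "orthogonal_matrix Q" "\<And>i. d$i \<noteq> 0"
  shows "matrix_inv (conj_diag Q d) = conj_diag Q (\<chi> i. inverse (d$i))"
proof -
  have "d * (\<chi> i. inverse (d$i)) = (\<chi> i. 1)" "(\<chi> i. inverse (d$i)) * d = (\<chi> i. 1)"
    using assms(2) by (auto simp: vec_eq_iff)
  then show ?thesis
    by (intro matrix_inv_eqI) (simp_all add: conj_diag_mult conj_diag_const assms(1))
qed

lemma cmat_mult: "cmat (A ** B) = cmat A ** cmat B"
  by (simp add: vec_eq_iff cmat_def matrix_matrix_mult_def)

lemma cmat_conj_diag: "cmat (conj_diag Q d) = conj_diag (cmat Q) (\<chi> i. of_real (d$i))"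
  by (simp add: vec_eq_iff cmat_def conj_diag_nth)

lemma orthogonal_matrix_cmat:
  assumes "orthogonal_matrix Q"
  shows "orthogonal_matrix (cmat Q)"
proof -
  have "transpose (cmat Q) = cmat (transpose Q)"
    by (simp add: vec_eq_iff cmat_def transpose_def)
  moreover have "cmat (mat 1) = (mat 1 :: complex^'a^'a)"
    by (simp add: vec_eq_iff cmat_def mat_def)
  ultimately show ?thesis
    using assms by (metis cmat_mult orthogonal_matrix_def)
qed

lemma cmat_centering: "cmat centering = centering"
  by (simp add: vec_eq_iff cmat_def centering_def)

lemma orthogonal_matrix_sum_squares:
  fixes Q :: "real^'n^'n"
  assumes "orthogonal_matrix Q"
  shows "(\<Sum>i\<in>UNIV. (\<Sum>j\<in>UNIV. Q$i$j * x j)\<^sup>2) = (\<Sum>i\<in>UNIV. (x i)\<^sup>2)"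
proof -
  let ?x = "\<chi> j. x j"
  have "(Q *v ?x) \<bullet> (Q *v ?x) = ?x \<bullet> ?x"
    using assms by (metis dot_lmul_matrix orthogonal_matrix_def transpose_matrix_vector
        matrix_vector_mul_assoc matrix_vector_mul_lid transpose_transpose)
  then show ?thesis
    by (simp add: inner_vec_def matrix_vector_mult_def power2_eq_square)
qed

text \<open>Since \<open>Q\<close> is real, it acts separately on the real and imaginary parts of
  each column and preserves both norms.\<close>

lemma trace_GHG_orthogonal_mult:
  fixes Q :: "real^'n^'n"
  assumes "orthogonal_matrix Q"
  shows "trace_GHG (cmat Q ** X) = trace_GHG X"
proof -
  have "trace_GHG (cmat Q ** X) = (\<Sum>k\<in>UNIV. (\<Sum>i\<in>UNIV. (\<Sum>j\<in>UNIV. Q$i$j * Re (X$j$k))\<^sup>2)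
      + (\<Sum>i\<in>UNIV. (\<Sum>j\<in>UNIV. Q$i$j * Im (X$j$k))\<^sup>2))"
    unfolding trace_GHG_def
    by (subst sum.swap) (simp add: cmod_power2 sum.distrib matrix_matrix_mult_def cmat_def)
  also have "\<dots> = trace_GHG X"
    unfolding orthogonal_matrix_sum_squares[OF assms] trace_GHG_def
    by (subst sum.swap[of "\<lambda>i k. (cmod (X$i$k))\<^sup>2"]) (simp add: cmod_power2 sum.distrib)
  finally show ?thesis .
qed

text \<open>Brings the centrality indices to the coordinates of \<open>B\<close> in the eigenbasis,
  the same weights that appear in \<open>trace_GHG_transfer\<close>.\<close>

lemma quadratic_conj_diag_nth:
  fixes B :: "'a::comm_ring_1^'m^'n"
  shows "(transpose B ** conj_diag Q d ** B)$k$k = (\<Sum>i\<in>UNIV. d$i * ((transpose Q ** B)$i$k)\<^sup>2)"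
proof -
  let ?Y = "transpose Q ** B"
  have "transpose B ** conj_diag Q d ** B = transpose ?Y ** diagm d ** ?Y"
    by (simp add: conj_diag_def matrix_transpose_mul matrix_mul_assoc)
  also have "\<dots> $k$k = (\<Sum>i\<in>UNIV. (transpose ?Y ** diagm d)$k$i * ?Y$i$k)"
    by (subst matrix_matrix_mult_def) simp
  also have "\<dots> = (\<Sum>i\<in>UNIV. d$i * (?Y$i$k)\<^sup>2)"
    by (simp add: matrix_mult_diagm_nth transpose_def power2_eq_square mult_ac)
  finally show ?thesis .
qed

subsection \<open>Graph Laplacians\<close>

lemma weighted_graph_symmetric:
  assumes "weighted_graph W"
  shows "W$i$j = W$j$i"
proof -
  have "transpose W $ j $ i = W $ j $ i"
    using assms by (simp add: weighted_graph_def)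
  then show ?thesis
    by (simp add: transpose_def)
qed

lemma laplacian_symmetric:
  assumes "weighted_graph W"
  shows "transpose (laplacian W) = laplacian W"
  using weighted_graph_symmetric[OF assms] by (simp add: vec_eq_iff transpose_def laplacian_def)

lemma laplacian_mult_nth: "(laplacian W *v x) $ i = (\<Sum>j\<in>UNIV. W$i$j * (x$i - x$j))"
proof -
  have "(laplacian W *v x) $ i = (\<Sum>j\<in>UNIV. (if i = j then (\<Sum>k\<in>UNIV. W$i$k) * x$j else 0) - W$i$j * x$j)"
    unfolding matrix_vector_mult_def laplacian_def by (auto intro!: sum.cong simp: algebra_simps)
  then show ?thesis
    by (simp add: sum_subtractf right_diff_distrib sum_distrib_right)
qed

text \<open>Exchanging the two summation indices gives a second expression for the form; added to
  the first, it completes the square.\<close>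

lemma laplacian_quadratic_form:
  assumes "weighted_graph W"
  shows "2 * (x \<bullet> (laplacian W *v x)) = (\<Sum>i\<in>UNIV. \<Sum>j\<in>UNIV. W$i$j * (x$i - x$j)\<^sup>2)"
proof -
  note W = weighted_graph_symmetric[OF assms]
  have 1: "x \<bullet> (laplacian W *v x) = (\<Sum>i\<in>UNIV. \<Sum>j\<in>UNIV. W$i$j * (x$i - x$j) * x$i)"
    by (simp add: inner_vec_def laplacian_mult_nth sum_distrib_left mult_ac)
  also have "\<dots> = (\<Sum>i\<in>UNIV. \<Sum>j\<in>UNIV. W$i$j * (x$j - x$i) * x$j)"
    by (subst sum.swap) (simp add: W)
  finally have 2: "x \<bullet> (laplacian W *v x) = (\<Sum>i\<in>UNIV. \<Sum>j\<in>UNIV. W$i$j * (x$j - x$i) * x$j)" .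
  have "2 * (x \<bullet> (laplacian W *v x)) = x \<bullet> (laplacian W *v x) + x \<bullet> (laplacian W *v x)"
    by simp
  also have "\<dots> = (\<Sum>i\<in>UNIV. \<Sum>j\<in>UNIV. W$i$j * (x$i - x$j) * x$i)
      + (\<Sum>i\<in>UNIV. \<Sum>j\<in>UNIV. W$i$j * (x$j - x$i) * x$j)"
    using 1 2 by simp
  also have "\<dots> = (\<Sum>i\<in>UNIV. \<Sum>j\<in>UNIV. W$i$j * (x$i - x$j)\<^sup>2)"
    unfolding sum.distrib[symmetric] by (intro sum.cong) (auto simp: power2_eq_square algebra_simps)
  finally show ?thesis .
qed

text \<open>The quadratic form is a sum of nonnegative terms; its vanishing makes \<open>x\<close>
  agree across every edge, hence along every path.\<close>

lemma laplacian_kernel_constant: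
  assumes W: "weighted_graph W" and con: "connected_graph W" and x: "laplacian W *v x = 0"
  shows "x$i = x$j"
proof -
  have nn: "0 \<le> W$i$j * (x$i - x$j)\<^sup>2" for i j
    using W by (simp add: weighted_graph_def)
  have "(\<Sum>i\<in>UNIV. \<Sum>j\<in>UNIV. W$i$j * (x$i - x$j)\<^sup>2) = 0"
    using laplacian_quadratic_form[OF W, of x] x by simp
  then have zero: "W$i$j * (x$i - x$j)\<^sup>2 = 0" for i j
    using nn by (simp add: sum_nonneg_eq_0_iff sum_nonneg)
  have "(i, j) \<in> (edges W)\<^sup>*"
    using con by (simp add: connected_graph_def)
  then show ?thesis
  proof (induction rule: rtrancl_induct)
    case (step y z)
    then show ?case using zero[of y z] by (simp add: edges_def)
  qed simp
qed

lemma laplacian_eigenvalue_nonneg: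
  assumes W: "weighted_graph W" and "laplacian W *v x = c *\<^sub>R x" "norm x = 1"
  shows "c \<ge> 0"
proof -
  have "(\<Sum>i\<in>UNIV. \<Sum>j\<in>UNIV. W$i$j * (x$i - x$j)\<^sup>2) \<ge> 0"
    using W by (intro sum_nonneg) (simp add: weighted_graph_def)
  moreover have "x \<bullet> x = 1"
    using assms(3) by (simp add: norm_eq_1)
  ultimately show ?thesis
    using laplacian_quadratic_form[OF W, of x] assms(2) by simp
qed

lemma centering_mult_nth:
  fixes x :: "real^'n"
  shows "(centering *v x) $ i = x$i - (\<Sum>j\<in>UNIV. x$j) / CARD('n)"
proof -
  have "(centering *v x) $ i = (\<Sum>j\<in>UNIV. (if i = j then x$j else 0) - x$j / CARD('n))"
    unfolding matrix_vector_mult_def centering_def by (auto intro!: sum.cong simp: algebra_simps)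
  then show ?thesis
    by (simp add: sum_subtractf sum_divide_distrib)
qed

text \<open>Diagonalises the centering matrix in the eigenbasis of the Laplacian: columns for
  eigenvalue 0 are constant vectors and are annihilated, the others are orthogonal to the constants
  and are fixed.\<close>

lemma centering_conj_diag:
  fixes W Q :: "real^'n^'n"
  assumes W: "weighted_graph W" and con: "connected_graph W" and Q: "orthogonal_matrix Q"
    and d: "\<And>i. laplacian W *v column i Q = d$i *\<^sub>R column i Q"
  shows "centering = conj_diag Q (\<chi> i. if d$i = 0 then 0 else 1)"
proof (rule eigenbasis_imp_conj_diag[OF Q])
  fix i
  let ?x = "column i Q"
  show "centering *v ?x = (\<chi> i. if d$i = 0 then 0 else 1)$i *\<^sub>R ?x"
  proof (cases "d$i = 0")
    case True
    then have const: "?x$j = ?x$k" for j k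
      using d by (intro laplacian_kernel_constant[OF W con]) simp
    have "(centering *v ?x)$k = 0" for k
    proof -
      have "(\<Sum>j\<in>UNIV. ?x$j) = (\<Sum>j\<in>(UNIV :: 'n set). ?x$k)"
        using const by (intro sum.cong) auto
      then show ?thesis
        by (simp add: centering_mult_nth)
    qed
    then show ?thesis
      using True by (simp add: vec_eq_iff)
  next
    case False
    have "laplacian W *v 1 = 0"
      by (simp add: vec_eq_iff laplacian_mult_nth)
    then have "1 \<bullet> (laplacian W *v ?x) = 0"
      using inner_matrix_vector_symmetric[OF laplacian_symmetric[OF W], of 1 ?x] by simp
    then have "(\<Sum>j\<in>UNIV. ?x$j) = 0"
      using False by (simp add: d inner_vec_def flip: sum_distrib_left)
    then show ?thesis
      using False by (simp add: vec_eq_iff centering_mult_nth)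
  qed
qed

subsection \<open>The performance measure\<close>

text \<open>In the eigenbasis the resolvent acts as a scalar on each mode, and the centering matrix
  deletes the modes of eigenvalue 0. For those modes \<open>nz\<close> requires
  \<open>s \<noteq> 0\<close>.\<close>

lemma trace_GHG_transfer:
  fixes W Q :: "real^'n^'n" and B :: "real^'m^'n"
  assumes W: "weighted_graph W" and con: "connected_graph W" and Q: "orthogonal_matrix Q"
    and d: "\<And>i. laplacian W *v column i Q = d$i *\<^sub>R column i Q"
    and nz: "\<And>i. s + exp (- (of_real \<tau> * s)) * of_real (d$i) \<noteq> 0"
  shows "trace_GHG (transfer (laplacian W) \<tau> B \<sigma> s) =
    (\<Sum>i\<in>UNIV. (if d$i = 0 then 0 else 1 / (cmod (s + exp (- (of_real \<tau> * s)) * of_real (d$i)))\<^sup>2)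
       * (\<Sum>k\<in>UNIV. ((transpose Q ** B)$i$k)\<^sup>2 * (\<sigma>$k)\<^sup>2))"
proof -
  let ?L = "laplacian W" and ?e = "exp (- (of_real \<tau> * s))"
  note cQ = orthogonal_matrix_cmat[OF Q]
  define \<psi> :: "complex^'n" where "\<psi> = (\<chi> i. if d$i = 0 then 0 else inverse (s + ?e * of_real (d$i)))"
  have L: "?L = conj_diag Q d"
    by (rule eigenbasis_imp_conj_diag[OF Q d])
  have "mat s + mat ?e ** cmat ?L
      = conj_diag (cmat Q) ((\<chi> i. s) + (\<chi> i. ?e) * (\<chi> i. of_real (d$i)))"
    unfolding L cmat_conj_diag conj_diag_const[OF cQ, symmetric] conj_diag_mult[OF cQ] conj_diag_add ..
  also have "(\<chi> i. s) + (\<chi> i. ?e) * (\<chi> i. of_real (d$i)) = (\<chi> i. s + ?e * of_real (d$i))"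
    by (simp add: vec_eq_iff)
  finally have inv: "matrix_inv (mat s + mat ?e ** cmat ?L)
      = conj_diag (cmat Q) (\<chi> i. inverse (s + ?e * of_real (d$i)))"
    using matrix_inv_conj_diag[OF cQ, of "\<chi> i. s + ?e * of_real (d$i)"] nz by simp
  have cen: "(centering :: complex^'n^'n) = conj_diag (cmat Q) (\<chi> i. if d$i = 0 then 0 else 1)"
    unfolding cmat_centering[symmetric] centering_conj_diag[OF W con Q d] cmat_conj_diag
    by (simp add: if_distrib cong: if_cong)
  have "(\<chi> i. if d$i = 0 then 0 else 1) * (\<chi> i. inverse (s + ?e * of_real (d$i))) = \<psi>"
    by (simp add: vec_eq_iff \<psi>_def)
  then have "centering ** matrix_inv (mat s + mat ?e ** cmat ?L) = conj_diag (cmat Q) \<psi>"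
    unfolding inv cen conj_diag_mult[OF cQ] by simp
  moreover have "transpose (cmat Q) = cmat (transpose Q)"
    by (simp add: vec_eq_iff cmat_def transpose_def)
  ultimately have "transfer ?L \<tau> B \<sigma> s = cmat Q ** (diagm \<psi> ** cmat (transpose Q ** B ** diagm \<sigma>))"
    by (simp add: transfer_def conj_diag_def cmat_mult matrix_mul_assoc)
  then have "trace_GHG (transfer ?L \<tau> B \<sigma> s) = trace_GHG (diagm \<psi> ** cmat (transpose Q ** B ** diagm \<sigma>))"
    by (simp add: trace_GHG_orthogonal_mult[OF Q])
  also have "\<dots> = (\<Sum>i\<in>UNIV. \<Sum>k\<in>UNIV. (cmod (\<psi>$i))\<^sup>2 * (((transpose Q ** B)$i$k)\<^sup>2 * (\<sigma>$k)\<^sup>2))"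
    unfolding trace_GHG_def diagm_matrix_mult_nth
    by (simp add: cmat_def matrix_mult_diagm_nth norm_mult power_mult_distrib)
  also have "\<dots> = (\<Sum>i\<in>UNIV. (cmod (\<psi>$i))\<^sup>2 * (\<Sum>k\<in>UNIV. ((transpose Q ** B)$i$k)\<^sup>2 * (\<sigma>$k)\<^sup>2))"
    by (simp add: sum_distrib_left)
  also have "\<dots> = (\<Sum>i\<in>UNIV. (if d$i = 0 then 0 else 1 / (cmod (s + ?e * of_real (d$i)))\<^sup>2)
       * (\<Sum>k\<in>UNIV. ((transpose Q ** B)$i$k)\<^sup>2 * (\<sigma>$k)\<^sup>2))"
    by (intro sum.cong) (auto simp: \<psi>_def norm_inverse power_inverse divide_inverse)
  finally show ?thesis .
qed

lemma rho_ss_eq_sum: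
  fixes W :: "real^'n^'n" and B :: "real^'m^'n" and \<sigma> :: "real^'m" and \<tau> :: real
  assumes W: "weighted_graph W" and con: "connected_graph W"
    and \<tau>: "\<tau> \<ge> 0" "\<tau> * max_eigenvalue (laplacian W) < pi / 2"
  defines "L \<equiv> laplacian W"
  shows "rho_ss L \<tau> B \<sigma> = (\<Sum>k\<in>UNIV.
    (transpose B ** pinv L ** mat_cos (\<tau> *\<^sub>R L) ** pinv (centering - mat_sin (\<tau> *\<^sub>R L)) ** B)$k$k / 2 * (\<sigma>$k)\<^sup>2)"
proof -
  have sym: "transpose L = L"
    unfolding L_def by (rule laplacian_symmetric[OF W])
  obtain Q d where Q: "orthogonal_matrix Q" and d: "\<And>i. L *v column i Q = d$i *\<^sub>R column i Q"
    using symmetric_orthogonal_eigenbasis[OF sym] by metis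
  have d_nonneg: "d$i \<ge> 0" for i
    using laplacian_eigenvalue_nonneg[OF W] d norm_column_orthogonal_matrix[OF Q] unfolding L_def by blast
  have d_less: "\<tau> * d$i < pi / 2" for i
    using mult_left_mono[OF eigenvalue_le_max_eigenvalue[OF sym Q d, of i] \<tau>(1)] \<tau>(2)
    unfolding L_def by linarith
  define b where "b i k = ((transpose Q ** B)$i$k)\<^sup>2" for i k
  define \<phi> where "\<phi> i = (if d$i = 0 then 0 else cos (\<tau> * d$i) / (d$i * (1 - sin (\<tau> * d$i))))" for i
  define J where "J i \<omega> = (if d$i = 0 then 0
      else 1 / (cmod (\<i> * of_real \<omega> + exp (- (of_real \<tau> * (\<i> * of_real \<omega>))) * of_real (d$i)))\<^sup>2)" for i \<omega>
  have J: "integrable lborel (J i)" "(LINT \<omega>|lborel. J i \<omega>) = pi * \<phi> i" for i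
    by (cases "d$i = 0"; use delay_integral[of "d$i" \<tau>] d_nonneg[of i] d_less[of i] \<tau>(1) in
        \<open>simp add: J_def[abs_def] \<phi>_def\<close>)+
  have L: "L = conj_diag Q d"
    by (rule eigenbasis_imp_conj_diag[OF Q d])
  have cen: "centering = conj_diag Q (\<chi> i. if d$i = 0 then 0 else 1)"
    using centering_conj_diag[OF W con Q] d unfolding L_def by blast
  \<comment> \<open>All factors are diagonal in the same basis. On a zero mode both pseudo-inverses
    have entry 0, matching the case \<open>d$i = 0\<close> of \<open>\<phi>\<close>.\<close>
  have "pinv L ** mat_cos (\<tau> *\<^sub>R L) ** pinv (centering - mat_sin (\<tau> *\<^sub>R L)) = conj_diag Q (\<chi> i. \<phi> i)"
    unfolding cen L conj_diag_scaleR mat_cos_conj_diag[OF Q] mat_sin_conj_diag[OF Q] conj_diag_diff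
      pinv_conj_diag[OF Q] conj_diag_mult[OF Q]
    by (rule arg_cong[of _ _ "conj_diag Q"]) (auto simp: vec_eq_iff \<phi>_def divide_inverse mult_ac)
  then have "transpose B ** pinv L ** mat_cos (\<tau> *\<^sub>R L) ** pinv (centering - mat_sin (\<tau> *\<^sub>R L)) ** B
      = transpose B ** conj_diag Q (\<chi> i. \<phi> i) ** B"
    by (metis matrix_mul_assoc)
  then have C: "(transpose B ** pinv L ** mat_cos (\<tau> *\<^sub>R L) ** pinv (centering - mat_sin (\<tau> *\<^sub>R L)) ** B)$k$k
      = (\<Sum>i\<in>UNIV. \<phi> i * b i k)" for k
    by (simp add: quadratic_conj_diag_nth b_def)
  define f where "f \<omega> = (\<Sum>i\<in>UNIV. J i \<omega> * (\<Sum>k\<in>UNIV. b i k * (\<sigma>$k)\<^sup>2))" for \<omega>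
  have tr: "trace_GHG (transfer L \<tau> B \<sigma> (\<i> * of_real \<omega>)) = f \<omega>" if "\<omega> \<noteq> 0" for \<omega>
  proof -
    have "\<i> * of_real \<omega> + exp (- (of_real \<tau> * (\<i> * of_real \<omega>))) * of_real (d$i) \<noteq> 0" for i
    proof (cases "d$i = 0")
      case False
      then show ?thesis
        using d_nonneg[of i] d_less[of i] \<tau>(1) by (intro delay_char_nonzero) auto
    qed (use that in auto)
    from trace_GHG_transfer[OF W con Q _ this] d show ?thesis
      unfolding f_def J_def b_def L_def by blast
  qed
  have "integrable lborel f"
    unfolding f_def by (intro Bochner_Integration.integrable_sum integrable_mult_left J)
  then have meas: "f \<in> borel_measurable lborel"
    by (rule borel_measurable_integrable)
  \<comment> \<open>At frequency 0 the matrix to invert is \<open>L\<close> itself, which is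
    singular, so \<open>matrix_inv\<close> yields an unspecified matrix there. A single point has
    measure zero and does not affect the integral.\<close>
  define K where "K = trace_GHG (transfer L \<tau> B \<sigma> (\<i> * of_real 0))"
  have "(LINT \<omega>|lborel. trace_GHG (transfer L \<tau> B \<sigma> (\<i> * of_real \<omega>))) = (LINT \<omega>|lborel. (if \<omega> = 0 then K else f \<omega>))"
    by (rule arg_cong[of _ _ "integral\<^sup>L lborel"]) (auto simp: fun_eq_iff K_def tr)
  also have "\<dots> = (LINT \<omega>|lborel. f \<omega>)"
  proof (rule integral_cong_AE)
    show "AE \<omega> in lborel. (if \<omega> = 0 then K else f \<omega>) = f \<omega>"
      using AE_lborel_singleton[of 0] by eventually_elim simp
    show "(\<lambda>\<omega>. if \<omega> = 0 then K else f \<omega>) \<in> borel_measurable lborel"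
      using meas by measurable
  qed (rule meas)
  also have "\<dots> = (\<Sum>i\<in>UNIV. pi * \<phi> i * (\<Sum>k\<in>UNIV. b i k * (\<sigma>$k)\<^sup>2))"
    unfolding f_def using J by (subst Bochner_Integration.integral_sum) (auto intro!: integrable_mult_left)
  also have "\<dots> = 2 * pi * (\<Sum>k\<in>UNIV. (\<Sum>i\<in>UNIV. \<phi> i * b i k) / 2 * (\<sigma>$k)\<^sup>2)"
  proof -
    have "(\<Sum>i\<in>UNIV. pi * \<phi> i * (\<Sum>k\<in>UNIV. b i k * (\<sigma>$k)\<^sup>2))
        = (\<Sum>i\<in>UNIV. \<Sum>k\<in>UNIV. pi * (\<phi> i * b i k * (\<sigma>$k)\<^sup>2))"
      by (simp add: sum_distrib_left mult_ac)
    also have "\<dots> = (\<Sum>k\<in>UNIV. \<Sum>i\<in>UNIV. pi * (\<phi> i * b i k * (\<sigma>$k)\<^sup>2))"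
      by (rule sum.swap)
    also have "\<dots> = 2 * pi * (\<Sum>k\<in>UNIV. (\<Sum>i\<in>UNIV. \<phi> i * b i k) / 2 * (\<sigma>$k)\<^sup>2)"
      by (simp add: sum_distrib_left sum_distrib_right sum_divide_distrib mult_ac)
    finally show ?thesis .
  qed
  finally show ?thesis
    unfolding rho_ss_def C by simp
qed

text \<open>The performance is affine in each noise intensity, so the index is its slope. The
  derivative is taken within the nonnegative reals because the varied quantity is an intensity; it
  is one-sided at \<open>\<sigma>$k = 0\<close>. The arbitrary index type \<open>'m\<close> covers
  agents and links alike.\<close>

theorem theorem2:
  fixes W :: "real^'n^'n" and B :: "real^'m^'n" and \<sigma> :: "real^'m" and \<tau> :: real
  assumes "weighted_graph W" and "connected_graph W"
    and "\<tau> \<ge> 0" and "\<tau> * max_eigenvalue (laplacian W) < pi / 2"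
  shows "let L = laplacian W;
             C = transpose B ** pinv L ** mat_cos (\<tau> *\<^sub>R L) ** pinv (centering - mat_sin (\<tau> *\<^sub>R L)) ** B;
             \<eta> = (\<lambda>k. C$k$k / 2)
         in rho_ss L \<tau> B \<sigma> = (\<Sum>k\<in>UNIV. \<eta> k * (\<sigma>$k)^2)
            \<and> (\<forall>k. ((\<lambda>v. rho_ss L \<tau> B (\<chi> j. if j = k then sqrt v else \<sigma>$j))
                      has_real_derivative \<eta> k) (at ((\<sigma>$k)^2) within {0..}))"
proof -
  define L where "L = laplacian W"
  define \<eta> where "\<eta> k = (transpose B ** pinv L ** mat_cos (\<tau> *\<^sub>R L)
    ** pinv (centering - mat_sin (\<tau> *\<^sub>R L)) ** B)$k$k / 2" for k
  have rho: "rho_ss L \<tau> B s = (\<Sum>k\<in>UNIV. \<eta> k * (s$k)\<^sup>2)" for s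
    unfolding L_def \<eta>_def by (rule rho_ss_eq_sum[OF assms])
  have "((\<lambda>v. rho_ss L \<tau> B (\<chi> j. if j = k then sqrt v else \<sigma>$j)) has_real_derivative \<eta> k)
      (at ((\<sigma>$k)\<^sup>2) within {0..})" for k
  proof (rule has_field_derivative_transform_within)
    show "((\<lambda>v. \<eta> k * v + (\<Sum>j\<in>UNIV - {k}. \<eta> j * (\<sigma>$j)\<^sup>2)) has_real_derivative \<eta> k)
        (at ((\<sigma>$k)\<^sup>2) within {0..})"
      by (auto intro!: derivative_eq_intros)
    fix v :: real
    assume "v \<in> {0..}"
    then show "\<eta> k * v + (\<Sum>j\<in>UNIV - {k}. \<eta> j * (\<sigma>$j)\<^sup>2)
        = rho_ss L \<tau> B (\<chi> j. if j = k then sqrt v else \<sigma>$j)"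
      unfolding rho by (subst sum.remove[of _ k]) auto
  qed (rule zero_less_one, simp)
  then show ?thesis
    using rho[of \<sigma>] unfolding Let_def L_def \<eta>_def by blast
qed

end
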